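(* Let $\mathcal{K}^A\subseteq\mathbb{C}_h^{n\times n}$ and $\mathcal{K}^B\subseteq\mathbb{C}_h^{m\times m}$ be maximal SDGs, with dual density matrices $\rho^A$ and $\rho^B$ respectively, and assume that their natural extension $\mathrm{ext}_{AB}(\mathcal{K}^A,\mathcal{K}^B)$ is separable, with dual $\mathcal{M}^{AB}$. Then for every $\rho^{AB}\in\mathcal{M}^{AB}$: $$\rho^{AB}\le\rho^A\otimes I_m\quad\text{and}\quad\rho^{AB}\le I_n\otimes\rho^B,$$ and $$\rho^{AB}\ge\rho^A\otimes I_m+I_n\otimes\rho^B-I_{nm}\quad\text{and}\quad\rho^{AB}\gneq 0.$$
   Context: $\mathbb{C}_h^{k\times k}$ is the real vector space of $k\times k$ complex Hermitian matrices, with inner product $G\cdot R=\mathrm{Tr}(G^\dagger R)$. $G\ge 0$ means positive semi-definite, $G\ge H$ means $G-H\ge 0$, $G\gneq 0$ means $G\ge 0$ and $G\ne 0$, $G>0$ means positive definite. $\mathcal{D}_h^{k\times k}$ is the set of $k\times k$ density matrices (positive semi-definite, trace one). $I_k$ is the $k\times k$ identity. A set $\mathcal{K}\subseteq\mathbb{C}_h^{k\times k}$ is a coherent set of strictly desirable gambles (SDG) if: (S1) it is closed under addition and under multiplication by reals $\nu>0$, and $0\notin\mathcal{K}$; (S2) every $G\gneq 0$ belongs to $\mathcal{K}$; (S3) if $G\in\mathcal{K}$ then either $G\gneq 0$ or $G-\Delta\in\mathcal{K}$ for some $\Delta>0$. It is maximal if no other SDG includes it. The dual of $\mathcal{K}$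 is $\{\rho\in\mathcal{D}_h^{k\times k}\mid G\cdot\rho\ge 0\ \forall G\in\mathcal{K}\}$; for a maximal SDG the dual is a singleton, whose element is called its dual density matrix. For an SDG $\mathcal{K}^{AB}\subseteq\mathbb{C}_h^{nm\times nm}$: $\mathrm{marg}_A(\mathcal{K}^{AB})=\{G\in\mathbb{C}_h^{n\times n}\mid G\otimes I_m\in\mathcal{K}^{AB}\}$ and $\mathrm{marg}_B(\mathcal{K}^{AB})=\{G\in\mathbb{C}_h^{m\times m}\mid I_n\otimes G\in\mathcal{K}^{AB}\}$. The natural extension $\mathrm{ext}_{AB}(\mathcal{K}^A,\mathcal{K}^B)$ is the smallest SDG $\mathcal{K}^{AB}$ in $\mathbb{C}_h^{nm\times nm}$ with $\mathrm{marg}_A(\mathcal{K}^{AB})=\mathcal{K}^A$ and $\mathrm{marg}_B(\mathcal{K}^{AB})=\mathcal{K}^B$. The natural extension is separable if its dual only includes separable density matrices, i.e. every $\rho^{AB}$ in the dual can be written as $\sum_i w_i\,\rho_i^A\otimes\rho_i^B$ with $w_i\ge 0$, $\sum_i w_i=1$, $\rho_i^A\in\mathcal{D}_h^{n\times n}$, $\rho_i^B\in\mathcal{D}_h^{m\times m}$, the sum being over a countable index set. *)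

theory Defs
  imports "HOL-Analysis.Analysis"
begin

text \<open>
  The \<open>k \<times> k\<close> complex matrices are \<open>complex^'k^'k\<close>, with \<open>k = CARD('k)\<close>.  The tensor product of
  an \<open>n \<times> n\<close> and an \<open>m \<times> m\<close> matrix has its rows and columns indexed by \<open>'n \<times> 'm\<close>, a type of
  cardinality \<open>n m\<close>.
\<close>

definition conj_transpose :: "complex^'k^'k \<Rightarrow> complex^'k^'k"
  where "conj_transpose G = (\<chi> i j. cnj (G $ j $ i))"

definition hermitian :: "complex^'k^'k \<Rightarrow> bool"
  where "hermitian G \<longleftrightarrow> conj_transpose G = G"

text \<open>The trace below is real whenever both matrices are Hermitian, so \<open>Re\<close> loses nothing.\<close>

definition gamble_inner :: "complex^'k^'k \<Rightarrow> complex^'k^'k \<Rightarrow> real"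
  where "gamble_inner G R = Re (trace (conj_transpose G ** R))"

text \<open>\<open>v\<^sup>\<dagger> G v\<close>; real for Hermitian \<open>G\<close>.\<close>

definition quad_form :: "complex^'k^'k \<Rightarrow> complex^'k \<Rightarrow> real"
  where "quad_form G v = Re (\<Sum>i\<in>UNIV. cnj (v $ i) * (G *v v) $ i)"

definition psd :: "complex^'k^'k \<Rightarrow> bool"
  where "psd G \<longleftrightarrow> hermitian G \<and> (\<forall>v. quad_form G v \<ge> 0)"

definition posdef :: "complex^'k^'k \<Rightarrow> bool"
  where "posdef G \<longleftrightarrow> hermitian G \<and> (\<forall>v. v \<noteq> 0 \<longrightarrow> quad_form G v > 0)"

definition psd_nonzero :: "complex^'k^'k \<Rightarrow> bool"
  where "psd_nonzero G \<longleftrightarrow> psd G \<and> G \<noteq> 0"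

definition psd_le :: "complex^'k^'k \<Rightarrow> complex^'k^'k \<Rightarrow> bool"  (infix "\<preceq>" 50)
  where "H \<preceq> G \<longleftrightarrow> psd (G - H)"

definition density_matrices :: "(complex^'k^'k) set"
  where "density_matrices = {\<rho>. psd \<rho> \<and> trace \<rho> = 1}"

definition tensor :: "complex^('n::finite)^('n::finite) \<Rightarrow> complex^('m::finite)^('m::finite) \<Rightarrow> complex^('n::finite \<times> 'm::finite)^('n::finite \<times> 'm::finite)"
    (infixl "\<otimes>" 70)
  where "A \<otimes> B = (\<chi> i j. A $ fst i $ fst j * B $ snd i $ snd j)"

definition SDG :: "(complex^'k^'k) set \<Rightarrow> bool"
  where "SDG K \<longleftrightarrow>
    K \<subseteq> Collect hermitian \<and>
    (\<forall>G\<in>K. \<forall>H\<in>K. G + H \<in> K) \<and>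
    (\<forall>G\<in>K. \<forall>\<nu>::real. \<nu> > 0 \<longrightarrow> \<nu> *\<^sub>R G \<in> K) \<and>
    0 \<notin> K \<and>
    (\<forall>G. psd_nonzero G \<longrightarrow> G \<in> K) \<and>
    (\<forall>G\<in>K. psd_nonzero G \<or> (\<exists>\<Delta>. posdef \<Delta> \<and> G - \<Delta> \<in> K))"

definition maximal_SDG :: "(complex^'k^'k) set \<Rightarrow> bool"
  where "maximal_SDG K \<longleftrightarrow> SDG K \<and> (\<forall>K'. SDG K' \<and> K \<subseteq> K' \<longrightarrow> K' = K)"

text \<open>
  The dual of a maximal SDG is a singleton, so \<open>\<rho> \<in> dual K\<close> says that \<open>\<rho>\<close> is its dual density
  matrix.
\<close>

definition dual :: "(complex^'k^'k) set \<Rightarrow> (complex^'k^'k) set"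
  where "dual K = {\<rho> \<in> density_matrices. \<forall>G\<in>K. gamble_inner G \<rho> \<ge> 0}"

definition marg_A :: "(complex^('n::finite \<times> 'm::finite)^('n::finite \<times> 'm::finite)) set \<Rightarrow> (complex^'n^'n) set"
  where "marg_A K = {G. hermitian G \<and> G \<otimes> mat 1 \<in> K}"

definition marg_B :: "(complex^('n::finite \<times> 'm::finite)^('n::finite \<times> 'm::finite)) set \<Rightarrow> (complex^'m^'m) set"
  where "marg_B K = {G. hermitian G \<and> mat 1 \<otimes> G \<in> K}"

text \<open>The order on sets is inclusion, so \<open>LEAST\<close> is the smallest such set.\<close>

definition natural_extension ::
  "(complex^'n^'n) set \<Rightarrow> (complex^'m^'m) set \<Rightarrow> (complex^('n::finite \<times> 'm::finite)^('n::finite \<times> 'm::finite)) set"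
  where "natural_extension KA KB = (LEAST K. SDG K \<and> marg_A K = KA \<and> marg_B K = KB)"

text \<open>Every countable index set is, up to relabelling, a set of natural numbers.\<close>

definition separable_density :: "complex^('n::finite \<times> 'm::finite)^('n::finite \<times> 'm::finite) \<Rightarrow> bool"
  where "separable_density \<rho> \<longleftrightarrow>
    (\<exists>(I :: nat set) (w :: nat \<Rightarrow> real) (\<rho>A :: nat \<Rightarrow> complex^'n^'n) (\<rho>B :: nat \<Rightarrow> complex^'m^'m).
      (\<forall>i\<in>I. w i \<ge> 0 \<and> \<rho>A i \<in> density_matrices \<and> \<rho>B i \<in> density_matrices) \<and>
      (w has_sum 1) I \<and>
      ((\<lambda>i. w i *\<^sub>R (\<rho>A i \<otimes> \<rho>B i)) has_sum \<rho>) I)"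

definition separable_SDG :: "(complex^('n::finite \<times> 'm::finite)^('n::finite \<times> 'm::finite)) set \<Rightarrow> bool"
  where "separable_SDG K \<longleftrightarrow> (\<forall>\<rho>\<in>dual K. separable_density \<rho>)"

end

theory Submission
  imports Defs
begin

text \<open>
  A maximal SDG with dual \<open>\<rho>\<close> is the open half-space \<open>G \<bullet> \<rho> > 0\<close> together with the nonzero positive
  semi-definite matrices, so its dual is a single point.  The half-space SDG of \<open>\<rho>A \<otimes> \<rho>B\<close> has the
  prescribed marginals; hence the cone generated by \<open>KA \<otimes> I\<close>, \<open>I \<otimes> KB\<close> and the positive
  semi-definite matrices avoids 0 and is the natural extension.  (Openness (S3) is lost under
  intersection, so the natural extension cannot be had by intersecting all candidates.)
  Elements of its dual therefore have partial traces \<open>\<rho>A\<close> and \<open>\<rho>B\<close>.  If such an element is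
  \<open>\<Sum>i. w i (\<alpha> i \<otimes> \<beta> i)\<close>, the three differences to be shown positive are the sums of
  \<open>w i (\<alpha> i \<otimes> (I - \<beta> i))\<close>, \<open>w i ((I - \<alpha> i) \<otimes> \<beta> i)\<close> and \<open>w i ((I - \<alpha> i) \<otimes> (I - \<beta> i))\<close>, and a
  density matrix is at most \<open>I\<close>.
\<close>

section \<open>Rank-one matrices and the real inner product\<close>

text \<open>The matrix v v^\<dagger>. Pairing with it turns the quadratic form into a linear
  function of the matrix, so positivity becomes a family of linear conditions.\<close>

definition outer :: "complex^'k \<Rightarrow> complex^'k^'k"
  where "outer v = (\<chi> i j. v $ i * cnj (v $ j))"

lemma complex_inner_eq_Re: "a \<bullet> b = Re (cnj a * b)" for a b :: complex
  by (simp add: inner_complex_def)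

text \<open>Both sides sum the real parts of \<open>cnj (G $ i $ j) * R $ i $ j\<close>, so the
  Euclidean inner product can stand in for the trace form.\<close>

lemma gamble_inner_eq: "gamble_inner G R = G \<bullet> R"
  unfolding gamble_inner_def trace_def conj_transpose_def matrix_matrix_mult_def inner_vec_def
  by (subst sum.swap) (simp add: complex_inner_eq_Re)

lemma quad_form_eq: "quad_form G v = G \<bullet> outer v"
  unfolding quad_form_def outer_def matrix_vector_mult_def inner_vec_def
  by (simp add: sum_distrib_left inner_complex_def algebra_simps)

lemma hermitian_iff: "hermitian G \<longleftrightarrow> (\<forall>i j. cnj (G $ j $ i) = G $ i $ j)"
  by (simp add: hermitian_def conj_transpose_def vec_eq_iff)

lemma hermitian_zero: "hermitian 0"
  and hermitian_mat_1: "hermitian (mat 1)"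
  and hermitian_add: "hermitian G \<Longrightarrow> hermitian H \<Longrightarrow> hermitian (G + H)"
  and hermitian_diff: "hermitian G \<Longrightarrow> hermitian H \<Longrightarrow> hermitian (G - H)"
  and hermitian_scaleR: "hermitian G \<Longrightarrow> hermitian (r *\<^sub>R G)"
  and hermitian_outer: "hermitian (outer v)"
  by (auto simp: hermitian_iff mat_def outer_def)

lemma hermitian_tensor: "hermitian A \<Longrightarrow> hermitian B \<Longrightarrow> hermitian (A \<otimes> B)"
  by (simp add: hermitian_iff tensor_def)

lemma psd_iff: "psd G \<longleftrightarrow> hermitian G \<and> (\<forall>v. 0 \<le> G \<bullet> outer v)"
  by (simp add: psd_def quad_form_eq)

lemma psd_zero: "psd 0"
  and psd_add: "psd G \<Longrightarrow> psd H \<Longrightarrow> psd (G + H)"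
  and psd_scaleR: "0 \<le> r \<Longrightarrow> psd G \<Longrightarrow> psd (r *\<^sub>R G)"
  by (simp_all add: psd_iff hermitian_zero hermitian_add hermitian_scaleR inner_add_left)

lemma outer_0 [simp]: "outer 0 = 0"
  by (simp add: outer_def vec_eq_iff)

lemma inner_outer_outer: "outer u \<bullet> outer v = (norm (\<Sum>i\<in>UNIV. cnj (u $ i) * v $ i))\<^sup>2"
proof -
  let ?z = "\<Sum>i\<in>UNIV. cnj (u $ i) * v $ i"
  have "outer u \<bullet> outer v = Re (?z * cnj ?z)"
    unfolding outer_def inner_vec_def cnj_sum sum_product Re_sum
    by (intro sum.cong refl) (simp add: complex_inner_eq_Re mult_ac)
  then show ?thesis
    by (metis Re_complex_of_real complex_norm_square)
qed

lemma psd_outer: "psd (outer v)"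
  by (simp add: psd_iff hermitian_outer inner_outer_outer)

lemma mat_1_inner: "mat 1 \<bullet> R = Re (trace R)"
proof -
  have "mat 1 \<bullet> R = (\<Sum>i\<in>UNIV. \<Sum>j\<in>UNIV. if i = j then Re (R $ i $ i) else 0)"
    unfolding inner_vec_def mat_def by (intro sum.cong refl) (auto simp: inner_complex_def)
  then show ?thesis by (simp add: trace_def)
qed

lemma trace_outer: "Re (trace (outer v)) = (norm v)\<^sup>2"
  unfolding power2_norm_eq_inner
  by (simp add: trace_def outer_def inner_vec_def inner_complex_def)

lemma psd_mat_1: "psd (mat 1)"
  by (simp add: psd_iff hermitian_mat_1 mat_1_inner trace_outer)

lemma posdef_mat_1: "posdef (mat 1)"
  by (simp add: posdef_def hermitian_mat_1 quad_form_eq mat_1_inner trace_outer)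

lemma outer_axis_inner: "G \<bullet> outer (axis k 1) = Re (G $ k $ k)"
proof -
  have "G \<bullet> outer (axis k 1) = (\<Sum>i\<in>UNIV. \<Sum>j\<in>UNIV. if j = k then if i = k then Re (G $ k $ k) else 0 else 0)"
    unfolding inner_vec_def outer_def
    by (intro sum.cong refl) (auto simp: inner_complex_def axis_def)
  then show ?thesis by simp
qed

section \<open>Elimination and rank-one decomposition\<close>

text \<open>Positivity at v - t e_k with t = s (A v)_k. Taking s = 1 / A_kk gives the elimination
  step; a large s shows that a zero diagonal entry kills its row.\<close>

lemma psd_shift:
  fixes A :: "complex^'k^'k"
  assumes "psd A"
  defines "c \<equiv> \<lambda>v k. norm ((A *v v) $ k)"
  shows "0 \<le> A \<bullet> outer v - 2 * s * (c v k)\<^sup>2 + s\<^sup>2 * (c v k)\<^sup>2 * Re (A $ k $ k)"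
proof -
  define z where "z = (A *v v) $ k"
  \<comment> \<open>With this \<open>t\<close> both cross terms equal s times the squared modulus of
    \<open>z\<close>.\<close>
  define t where "t = of_real s * z"
  define e :: "complex^'k" where "e = axis k 1"
  have herm: "cnj (A $ j $ i) = A $ i $ j" for i j
    using assms(1) by (simp add: psd_iff hermitian_iff)
  have Ae: "(A *v e) $ i = A $ i $ k" for i
    by (simp add: matrix_vector_mult_def e_def axis_def if_distrib cong: if_cong)
  have conj: "(\<Sum>i\<in>UNIV. cnj (v $ i) * A $ i $ k) = cnj z"
    by (simp add: z_def matrix_vector_mult_def herm mult.commute)
  have ek: "(\<Sum>i\<in>UNIV. cnj (e $ i) * f i) = f k" for f
    by (simp add: e_def axis_def if_distrib if_distribR cong: if_cong)
  have "0 \<le> quad_form A (v - t *s e)"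
    using assms(1) by (simp add: psd_def)
  also have "quad_form A (v - t *s e) =
      Re (\<Sum>i\<in>UNIV. cnj (v $ i) * (A *v v) $ i - t * (cnj (v $ i) * A $ i $ k)
        - cnj t * (cnj (e $ i) * (A *v v) $ i) + cnj t * t * (cnj (e $ i) * A $ i $ k))"
    unfolding quad_form_def matrix_vector_mult_diff_distrib vector_scalar_commute
    by (rule arg_cong[where f = Re], rule sum.cong[OF refl]) (simp add: Ae algebra_simps)
  also have "\<dots> = quad_form A v - Re (t * cnj z) - Re (cnj t * z) + Re (cnj t * t * A $ k $ k)"
    by (simp only: sum.distrib sum_subtractf sum_distrib_left[symmetric] conj ek z_def[symmetric]
        quad_form_def plus_complex.sel minus_complex.sel)
  also have "\<dots> = A \<bullet> outer v - 2 * s * (norm z)\<^sup>2 + s\<^sup>2 * (norm z)\<^sup>2 * Re (A $ k $ k)"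
    by (simp add: quad_form_eq t_def cmod_power2) (simp add: algebra_simps power2_eq_square)
  finally show ?thesis by (simp add: c_def z_def)
qed

lemma psd_diag_nonneg: "psd A \<Longrightarrow> 0 \<le> Re (A $ k $ k)"
  by (metis outer_axis_inner psd_iff)

lemma psd_diag_real: "psd A \<Longrightarrow> A $ k $ k = of_real (Re (A $ k $ k))"
  unfolding psd_iff hermitian_iff by (metis Reals_cnj_iff of_real_Re)

text \<open>At \<open>axis j 1\<close> the bound of \<open>psd_shift\<close> is affine in s, because
  its quadratic term carries the zero diagonal entry. A nonzero entry A_kj would give it negative
  slope, hence negative values.\<close>

lemma psd_zero_diag:
  assumes "psd A" "A $ k $ k = 0"
  shows "A $ k $ j = 0"
proof (rule ccontr)
  let ?v = "axis j 1"
  assume nz: "A $ k $ j \<noteq> 0"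
  have Ae: "(A *v ?v) $ k = A $ k $ j"
    by (simp add: matrix_vector_mult_def axis_def if_distrib cong: if_cong)
  let ?n = "(norm (A $ k $ j))\<^sup>2"
  have "0 \<le> A \<bullet> outer ?v - 2 * s * ?n" for s
    using psd_shift[OF assms(1), of ?v s k] assms(2) by (simp add: Ae)
  \<comment> \<open>This \<open>s\<close> makes the bound equal to -q - 2, where q is the
    nonnegative number \<open>A \<bullet> outer ?v\<close>.\<close>
  from this[of "(A \<bullet> outer ?v + 1) / ?n"] nz
  have "0 \<le> A \<bullet> outer ?v - 2 * (A \<bullet> outer ?v + 1)" by simp
  moreover have "0 \<le> A \<bullet> outer ?v" using assms(1) by (simp add: psd_iff)
  ultimately show False by simp
qed

text \<open>Cholesky elimination: subtracting the outer product of a normalised column clears a diagonal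
  entry, keeps the matrix positive semi-definite, and does not disturb the zero rows.\<close>

lemma psd_induct [consumes 1, case_names zero outer]:
  fixes A :: "complex^'k^'k"
  assumes "psd A" and P0: "P 0" and Pouter: "\<And>u B. psd B \<Longrightarrow> P B \<Longrightarrow> P (outer u + B)"
  shows "P A"
  using assms(1)
proof (induction "card {i. A $ i $ i \<noteq> 0}" arbitrary: A rule: less_induct)
  case less
  show ?case
  proof (cases "\<exists>k. A $ k $ k \<noteq> 0")
    case False
    then have "A = 0" by (simp add: vec_eq_iff psd_zero_diag[OF less.prems])
    with P0 show ?thesis by simp
  next
    case True
    then obtain k where k: "A $ k $ k \<noteq> 0" by blast
    define a where "a = Re (A $ k $ k)"
    have Akk: "A $ k $ k = of_real a" unfolding a_def by (rule psd_diag_real[OF less.prems])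
    have "a \<noteq> 0" using k Akk by auto
    with psd_diag_nonneg[OF less.prems, of k] have a: "a > 0" by (simp add: a_def)
    have herm: "cnj (A $ j $ i) = A $ i $ j" for i j
      using less.prems by (simp add: psd_iff hermitian_iff)
    \<comment> \<open>The scaling makes \<open>outer u\<close> agree with \<open>A\<close> on row
      and column \<open>k\<close>.\<close>
    define u :: "complex^'k" where "u = (\<chi> i. A $ i $ k / of_real (sqrt a))"
    define B where "B = A - outer u"
    have sq: "complex_of_real (sqrt a) * complex_of_real (sqrt a) = of_real a"
      using a by (simp flip: of_real_mult)
    have ou: "outer u $ i $ j = A $ i $ k * A $ k $ j / of_real a" for i j
      by (simp add: outer_def u_def herm sq)
    have psdB: "psd B"
      unfolding psd_iff
    proof (intro conjI allI)
      show "hermitian B" unfolding B_def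
        using less.prems by (intro hermitian_diff hermitian_outer) (simp add: psd_iff)
      fix v
      have "(\<Sum>i\<in>UNIV. cnj (u $ i) * v $ i) = (A *v v) $ k / of_real (sqrt a)"
        by (simp add: u_def matrix_vector_mult_def herm sum_divide_distrib)
      then have "outer u \<bullet> outer v = (norm ((A *v v) $ k))\<^sup>2 / a"
        using a by (simp add: inner_outer_outer norm_divide power_divide)
      \<comment> \<open>At s = 1 / a the two correction terms combine to minus the squared norm over
        a, which is what subtracting \<open>outer u\<close> costs.\<close>
      moreover have "0 \<le> A \<bullet> outer v - (norm ((A *v v) $ k))\<^sup>2 / a"
        using psd_shift[OF less.prems, of v "1 / a" k] a
        by (simp add: a_def[symmetric] power2_eq_square)
      ultimately show "0 \<le> B \<bullet> outer v" by (simp add: B_def inner_diff_left)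
    qed
    have "{i. B $ i $ i \<noteq> 0} \<subset> {i. A $ i $ i \<noteq> 0}"
    proof -
      have "B $ k $ k = 0" using a by (simp add: B_def ou Akk)
      moreover have "B $ i $ i = 0" if "A $ i $ i = 0" for i
        using psd_zero_diag[OF less.prems that] that by (simp add: B_def ou)
      ultimately show ?thesis using k by auto
    qed
    then have "card {i. B $ i $ i \<noteq> 0} < card {i. A $ i $ i \<noteq> 0}"
      by (simp add: psubset_card_mono)
    from Pouter[OF psdB less.hyps[OF this psdB], of u] show ?thesis by (simp add: B_def)
  qed
qed

section \<open>Positivity of inner products\<close>

text \<open>Expanding \<open>R\<close> into rank-one matrices, each term contributes a value of the
  quadratic form of \<open>G\<close>.\<close>

lemma psd_inner_nonneg:
  assumes "psd G" "psd R"
  shows "0 \<le> G \<bullet> R"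
  using assms(2)
  by (induction R rule: psd_induct) (use assms(1) in \<open>simp_all add: psd_iff inner_add_right\<close>)

lemma posdef_imp_psd: "posdef G \<Longrightarrow> psd G"
  unfolding posdef_def psd_def
  by (metis inner_zero_right less_imp_le order_refl outer_0 quad_form_eq)

text \<open>The same expansion is strict as soon as one of the vectors is nonzero, and some vector
  is because \<open>R\<close> is.\<close>

lemma posdef_inner_pos:
  assumes "posdef G" "psd R" "R \<noteq> 0"
  shows "0 < G \<bullet> R"
  using assms(2,3)
proof (induction R rule: psd_induct)
  case (outer u B)
  show ?case
  proof (cases "u = 0")
    case False
    then have "0 < G \<bullet> outer u" using assms(1) by (simp add: posdef_def quad_form_eq)
    moreover have "0 \<le> G \<bullet> B"
      using outer.hyps assms(1) by (simp add: posdef_imp_psd psd_inner_nonneg)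
    ultimately show ?thesis by (simp add: inner_add_right)
  qed (use outer in simp)
qed simp

text \<open>Pairing with the identity rules out cancellation: it is positive on a nonzero
  \<open>G\<close> and nonnegative on \<open>H\<close>.\<close>

lemma psd_add_eq_0:
  assumes "psd G" "psd H" "G + H = 0"
  shows "G = 0"
  using posdef_inner_pos[OF posdef_mat_1 assms(1)] psd_inner_nonneg[OF psd_mat_1 assms(2)]
    assms(3) by (metis inner_add_right inner_zero_right add_pos_nonneg less_irrefl)

section \<open>Tensor products\<close>

lemma tensor_add_left: "(A + B) \<otimes> C = A \<otimes> C + B \<otimes> C"
  and tensor_add_right: "C' \<otimes> (A' + B') = C' \<otimes> A' + C' \<otimes> B'"
  and tensor_diff_left: "(A - B) \<otimes> C = A \<otimes> C - B \<otimes> C"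
  and tensor_diff_right: "C' \<otimes> (A' - B') = C' \<otimes> A' - C' \<otimes> B'"
  and tensor_scaleR_left: "(r *\<^sub>R A) \<otimes> C = r *\<^sub>R (A \<otimes> C)"
  and tensor_scaleR_right: "C' \<otimes> (r *\<^sub>R A') = r *\<^sub>R (C' \<otimes> A')"
  and tensor_zero_left [simp]: "0 \<otimes> C = 0"
  and tensor_zero_right [simp]: "C' \<otimes> 0 = 0"
  by (simp_all add: tensor_def vec_eq_iff algebra_simps)

lemma tensor_mat_1: "mat 1 \<otimes> mat 1 = mat 1"
  by (auto simp: tensor_def mat_def vec_eq_iff prod_eq_iff)

text \<open>Allows a fixed tensor factor to pass through an infinite sum.\<close>

lemma bounded_linear_tensor_left: "bounded_linear (\<lambda>A. A \<otimes> C)"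
  by (simp add: linear_conv_bounded_linear[symmetric] linear_iff tensor_add_left tensor_scaleR_left)

lemma bounded_linear_tensor_right: "bounded_linear (\<lambda>A. C \<otimes> A)"
  by (simp add: linear_conv_bounded_linear[symmetric] linear_iff tensor_add_right tensor_scaleR_right)

lemma outer_tensor_outer: "outer u \<otimes> outer v = outer (\<chi> i. u $ fst i * v $ snd i)"
  by (simp add: tensor_def outer_def vec_eq_iff)

text \<open>Bilinearity and rank-one induction on each factor reduce this to
  \<open>outer_tensor_outer\<close>.\<close>

lemma psd_tensor:
  assumes "psd A" "psd B"
  shows "psd (A \<otimes> B)"
  using assms(1)
proof (induction A rule: psd_induct)
  case (outer u A)
  have "psd (outer u \<otimes> B)"
    using assms(2)
    by (induction B rule: psd_induct)
      (simp_all add: psd_zero psd_add psd_outer tensor_add_right outer_tensor_outer)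
  then show ?case using outer.IH by (simp add: tensor_add_left psd_add)
qed (simp add: psd_zero)

section \<open>Partial traces\<close>

text \<open>The suffix names the system traced out, so the result lives on the first factor.\<close>

definition ptrace_B :: "complex^('n::finite \<times> 'm::finite)^('n \<times> 'm) \<Rightarrow> complex^'n^'n"
  where "ptrace_B R = (\<chi> i j. \<Sum>b\<in>UNIV. R $ (i, b) $ (j, b))"

definition ptrace_A :: "complex^('n::finite \<times> 'm::finite)^('n \<times> 'm) \<Rightarrow> complex^'m^'m"
  where "ptrace_A R = (\<chi> i j. \<Sum>a\<in>UNIV. R $ (a, i) $ (a, j))"

lemma bounded_linear_ptrace_B: "bounded_linear ptrace_B"
  by (auto simp: linear_conv_bounded_linear[symmetric] linear_iff ptrace_B_def vec_eq_iff
      sum.distrib scaleR_sum_right)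

lemma bounded_linear_ptrace_A: "bounded_linear ptrace_A"
  by (auto simp: linear_conv_bounded_linear[symmetric] linear_iff ptrace_A_def vec_eq_iff
      sum.distrib scaleR_sum_right)

lemma sum_prod_UNIV:
  "(\<Sum>i\<in>UNIV. f i) = (\<Sum>a\<in>UNIV. \<Sum>b\<in>UNIV. f (a, b))"
  for f :: "'a::finite \<times> 'b::finite \<Rightarrow> 'c::comm_monoid_add"
  by (simp add: sum.cartesian_product UNIV_Times_UNIV[symmetric] del: UNIV_Times_UNIV)

lemma trace_ptrace_B: "trace (ptrace_B R) = trace R"
  by (simp add: trace_def ptrace_B_def sum_prod_UNIV)

lemma trace_ptrace_A: "trace (ptrace_A R) = trace R"
  by (simp add: trace_def ptrace_A_def sum_prod_UNIV sum.swap[of "\<lambda>i a. R $ (a, i) $ (a, i)"])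

lemma ptrace_B_tensor: "trace B = 1 \<Longrightarrow> ptrace_B (A \<otimes> B) = A"
  by (simp add: ptrace_B_def tensor_def trace_def vec_eq_iff sum_distrib_left[symmetric])

lemma ptrace_A_tensor: "trace A = 1 \<Longrightarrow> ptrace_A (A \<otimes> B) = B"
  by (simp add: ptrace_A_def tensor_def trace_def vec_eq_iff sum_distrib_right[symmetric])

text \<open>Only entries with equal second indices survive on the left, and summing over these is
  the partial trace. This adjointness turns conditions on marginal gambles into conditions on
  reduced matrices.\<close>

lemma inner_tensor_mat_1: "(G \<otimes> mat 1) \<bullet> R = G \<bullet> ptrace_B R"
proof -
  have "(G \<otimes> mat 1) \<bullet> R =
      (\<Sum>i\<in>UNIV. \<Sum>b\<in>UNIV. \<Sum>j\<in>UNIV. \<Sum>d\<in>UNIV. if b = d then G $ i $ j \<bullet> R $ (i, b) $ (j, b) else 0)"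
    unfolding inner_vec_def sum_prod_UNIV by (intro sum.cong refl) (auto simp: tensor_def mat_def)
  also have "\<dots> = (\<Sum>i\<in>UNIV. \<Sum>b\<in>UNIV. \<Sum>j\<in>UNIV. G $ i $ j \<bullet> R $ (i, b) $ (j, b))"
    by simp
  also have "\<dots> = (\<Sum>i\<in>UNIV. \<Sum>j\<in>UNIV. \<Sum>b\<in>UNIV. G $ i $ j \<bullet> R $ (i, b) $ (j, b))"
    by (intro sum.cong refl) (rule sum.swap)
  finally show ?thesis by (simp add: inner_vec_def ptrace_B_def inner_sum_right)
qed

lemma inner_mat_1_tensor: "(mat 1 \<otimes> G) \<bullet> R = G \<bullet> ptrace_A R"
proof -
  have "(mat 1 \<otimes> G) \<bullet> R =
      (\<Sum>a\<in>UNIV. \<Sum>i\<in>UNIV. \<Sum>c\<in>UNIV. \<Sum>j\<in>UNIV. if a = c then G $ i $ j \<bullet> R $ (a, i) $ (a, j) else 0)"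
    unfolding inner_vec_def sum_prod_UNIV by (intro sum.cong refl) (auto simp: tensor_def mat_def)
  also have "\<dots> = (\<Sum>a\<in>UNIV. \<Sum>i\<in>UNIV. \<Sum>j\<in>UNIV. G $ i $ j \<bullet> R $ (a, i) $ (a, j))"
    by (intro sum.cong refl, subst sum.swap) simp
  also have "\<dots> = (\<Sum>i\<in>UNIV. \<Sum>j\<in>UNIV. \<Sum>a\<in>UNIV. G $ i $ j \<bullet> R $ (a, i) $ (a, j))"
    by (subst sum.swap) (intro sum.cong refl, rule sum.swap)
  finally show ?thesis by (simp add: inner_vec_def ptrace_A_def inner_sum_right)
qed

text \<open>By adjointness the quadratic form at v is the pairing of \<open>R\<close> with
  \<open>outer v \<otimes> mat 1\<close>.\<close>

lemma psd_ptrace_B: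
  assumes "psd R"
  shows "psd (ptrace_B R)"
  unfolding psd_iff
proof (intro conjI allI)
  show "hermitian (ptrace_B R)" using assms by (simp add: psd_iff hermitian_iff ptrace_B_def)
  show "0 \<le> ptrace_B R \<bullet> outer v" for v
    using psd_inner_nonneg[OF psd_tensor[OF psd_outer psd_mat_1] assms]
    by (metis inner_tensor_mat_1 inner_commute)
qed

lemma psd_ptrace_A:
  assumes "psd R"
  shows "psd (ptrace_A R)"
  unfolding psd_iff
proof (intro conjI allI)
  show "hermitian (ptrace_A R)" using assms by (simp add: psd_iff hermitian_iff ptrace_A_def)
  show "0 \<le> ptrace_A R \<bullet> outer v" for v
    using psd_inner_nonneg[OF psd_tensor[OF psd_mat_1 psd_outer] assms]
    by (metis inner_mat_1_tensor inner_commute)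
qed

text \<open>The quadratic form at v pairs \<open>D\<close> with the partial trace of
  \<open>outer v\<close>, which is nonzero since its trace is the squared norm of v.\<close>

lemma posdef_tensor_mat_1:
  fixes D :: "complex^'n^'n"
  assumes "posdef D"
  shows "posdef (D \<otimes> mat 1 :: complex^('n \<times> 'm::finite)^('n \<times> 'm))"
  unfolding posdef_def quad_form_eq
proof (intro conjI allI impI)
  show "hermitian (D \<otimes> mat 1 :: complex^('n \<times> 'm)^('n \<times> 'm))"
    using assms by (intro hermitian_tensor hermitian_mat_1) (simp add: posdef_def)
  fix v :: "complex^('n \<times> 'm)" assume "v \<noteq> 0"
  then have "trace (ptrace_B (outer v)) \<noteq> 0"
    using trace_outer[of v] by (auto simp: trace_ptrace_B)
  then have "ptrace_B (outer v) \<noteq> 0" by (auto simp: trace_def)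
  with assms show "0 < (D \<otimes> mat 1) \<bullet> outer v"
    by (simp add: inner_tensor_mat_1 posdef_inner_pos psd_ptrace_B psd_outer)
qed

lemma posdef_mat_1_tensor:
  fixes D :: "complex^'m^'m"
  assumes "posdef D"
  shows "posdef (mat 1 \<otimes> D :: complex^('n::finite \<times> 'm)^('n \<times> 'm))"
  unfolding posdef_def quad_form_eq
proof (intro conjI allI impI)
  show "hermitian (mat 1 \<otimes> D :: complex^('n \<times> 'm)^('n \<times> 'm))"
    using assms by (intro hermitian_tensor hermitian_mat_1) (simp add: posdef_def)
  fix v :: "complex^('n \<times> 'm)" assume "v \<noteq> 0"
  then have "trace (ptrace_A (outer v)) \<noteq> 0"
    using trace_outer[of v] by (auto simp: trace_ptrace_A)
  then have "ptrace_A (outer v) \<noteq> 0" by (auto simp: trace_def)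
  with assms show "0 < (mat 1 \<otimes> D) \<bullet> outer v"
    by (simp add: inner_mat_1_tensor posdef_inner_pos psd_ptrace_A psd_outer)
qed

lemma trace_outer_axis: "trace (outer (axis k 1)) = 1"
proof -
  have "outer (axis k 1) $ i $ i = (if i = k then 1 else 0)" for i
    by (simp add: outer_def axis_def)
  then show ?thesis by (simp add: trace_def)
qed

text \<open>Tensoring \<open>outer v\<close> with a projection of trace one recovers the quadratic
  form of \<open>G\<close> at v. Any axis serves, hence \<open>undefined\<close>.\<close>

lemma psd_tensor_mat_1D:
  fixes G :: "complex^'n^'n"
  assumes "psd (G \<otimes> mat 1 :: complex^('n \<times> 'm::finite)^('n \<times> 'm))" "hermitian G"
  shows "psd G"
  unfolding psd_iff
proof (intro conjI allI)
  fix v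
  have "0 \<le> (G \<otimes> mat 1) \<bullet> (outer v \<otimes> outer (axis (undefined :: 'm) 1))"
    by (rule psd_inner_nonneg[OF assms(1) psd_tensor[OF psd_outer psd_outer]])
  then show "0 \<le> G \<bullet> outer v"
    by (simp add: inner_tensor_mat_1 ptrace_B_tensor trace_outer_axis)
qed fact

lemma psd_mat_1_tensorD:
  fixes G :: "complex^'m^'m"
  assumes "psd (mat 1 \<otimes> G :: complex^('n::finite \<times> 'm)^('n \<times> 'm))" "hermitian G"
  shows "psd G"
  unfolding psd_iff
proof (intro conjI allI)
  fix v
  have "0 \<le> (mat 1 \<otimes> G) \<bullet> (outer (axis (undefined :: 'n) 1) \<otimes> outer v)"
    by (rule psd_inner_nonneg[OF assms(1) psd_tensor[OF psd_outer psd_outer]])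
  then show "0 \<le> G \<bullet> outer v"
    by (simp add: inner_mat_1_tensor ptrace_A_tensor trace_outer_axis)
qed fact

lemma tensor_mat_1_eq_0:
  fixes G :: "complex^'n^'n"
  assumes "(G \<otimes> mat 1 :: complex^('n \<times> 'm::finite)^('n \<times> 'm)) = 0"
  shows "G = 0"
proof -
  have "(G \<otimes> mat 1 :: complex^('n \<times> 'm)^('n \<times> 'm)) $ (i, b) $ (j, b) = 0" for i j b
    by (simp add: assms)
  then show ?thesis by (simp add: tensor_def mat_def vec_eq_iff)
qed

lemma mat_1_tensor_eq_0:
  fixes G :: "complex^'m^'m"
  assumes "(mat 1 \<otimes> G :: complex^('n::finite \<times> 'm)^('n \<times> 'm)) = 0"
  shows "G = 0"
proof -
  have "(mat 1 \<otimes> G :: complex^('n \<times> 'm)^('n \<times> 'm)) $ (a, i) $ (a, j) = 0" for i j a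
    by (simp add: assms)
  then show ?thesis by (simp add: tensor_def mat_def vec_eq_iff)
qed

section \<open>Density matrices and infinite sums\<close>

lemma density_matricesD:
  assumes "\<rho> \<in> density_matrices"
  shows "psd \<rho>" "hermitian \<rho>" "trace \<rho> = 1" "\<rho> \<noteq> 0"
  using assms by (auto simp: density_matrices_def psd_iff trace_def)

lemma trace_tensor: "trace (A \<otimes> B) = trace A * trace B"
  by (simp add: trace_def tensor_def sum_prod_UNIV sum_product)

lemma density_tensor:
  "\<rho> \<in> density_matrices \<Longrightarrow> \<sigma> \<in> density_matrices \<Longrightarrow> \<rho> \<otimes> \<sigma> \<in> density_matrices"
  by (simp add: density_matrices_def psd_tensor trace_tensor)

text \<open>For rank-one matrices this is Cauchy-Schwarz, and both sides are additive in
  \<open>R\<close>. At trace one the bound is the quadratic form of the identity.\<close>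

lemma psd_inner_outer_le:
  assumes "psd R"
  shows "R \<bullet> outer v \<le> Re (trace R) * (norm v)\<^sup>2"
  using assms
proof (induction R rule: psd_induct)
  case (outer u B)
  have "norm (\<Sum>i\<in>UNIV. cnj (u $ i) * v $ i) \<le> (\<Sum>i\<in>UNIV. norm (u $ i) * norm (v $ i))"
    by (rule sum_norm_le) (simp add: norm_mult)
  also have "\<dots> \<le> norm u * norm v"
    using L2_set_mult_ineq[of "\<lambda>i. norm (u $ i)" "\<lambda>i. norm (v $ i)" UNIV] by (simp add: norm_vec_def)
  finally have "outer u \<bullet> outer v \<le> (norm u)\<^sup>2 * (norm v)\<^sup>2"
    unfolding inner_outer_outer power_mult_distrib[symmetric] by (rule power_mono) simp
  with outer.IH show ?case
    by (simp add: inner_add_left trace_add trace_outer distrib_right)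
qed (simp add: trace_def)

lemma psd_mat_1_diff_density:
  assumes "\<rho> \<in> density_matrices"
  shows "psd (mat 1 - \<rho>)"
  using psd_inner_outer_le[of \<rho>] density_matricesD[OF assms]
  by (simp add: psd_iff hermitian_diff hermitian_mat_1 inner_diff_left mat_1_inner trace_outer)

lemma has_sum_diff:
  fixes f g :: "'a \<Rightarrow> 'b::real_normed_vector"
  assumes "(f has_sum a) A" "(g has_sum b) A"
  shows "((\<lambda>x. f x - g x) has_sum (a - b)) A"
  using has_sum_add[OF assms(1), of "\<lambda>x. - g x" "- b"] assms(2)
  by (simp add: has_sum_uminus)

text \<open>The cone is closed: pairing with \<open>outer v\<close> and conjugate transposition are
  bounded linear, so both conditions pass to the sum.\<close>

lemma psd_has_sum:
  assumes "(f has_sum S) I" "\<And>i. i \<in> I \<Longrightarrow> psd (f i)"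
  shows "psd S"
  unfolding psd_iff
proof (intro conjI allI)
  fix v
  have "((\<lambda>i. f i \<bullet> outer v) has_sum (S \<bullet> outer v)) I"
    using has_sum_bounded_linear[OF bounded_linear_inner_left assms(1)] by (simp add: o_def)
  then show "0 \<le> S \<bullet> outer v"
    by (rule has_sum_nonneg) (use assms(2) in \<open>simp add: psd_iff\<close>)
next
  have "bounded_linear conj_transpose"
    by (auto simp: linear_conv_bounded_linear[symmetric] linear_iff conj_transpose_def vec_eq_iff)
  from has_sum_bounded_linear[OF this assms(1)]
  have "((\<lambda>i. conj_transpose (f i)) has_sum conj_transpose S) I" by (simp add: o_def)
  also have "?this \<longleftrightarrow> (f has_sum conj_transpose S) I"
    by (rule has_sum_cong) (use assms(2) in \<open>simp add: psd_iff hermitian_def\<close>)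
  finally show "hermitian S"
    unfolding hermitian_def using assms(1) by (rule has_sum_unique)
qed

section \<open>Desirable gambles and half-spaces\<close>

lemma SDGD:
  assumes "SDG K"
  shows SDG_hermitian: "G \<in> K \<Longrightarrow> hermitian G"
    and SDG_add: "G \<in> K \<Longrightarrow> H \<in> K \<Longrightarrow> G + H \<in> K"
    and SDG_scaleR: "G \<in> K \<Longrightarrow> 0 < r \<Longrightarrow> r *\<^sub>R G \<in> K"
    and SDG_zero: "0 \<notin> K"
    and SDG_psd: "psd_nonzero G \<Longrightarrow> G \<in> K"
    and SDG_open: "G \<in> K \<Longrightarrow> \<not> psd G \<Longrightarrow> \<exists>D. posdef D \<and> G - D \<in> K"
  using assms by (auto simp: SDG_def psd_nonzero_def)

text \<open>Since 0 is positive semi-definite, a component of a cone element that may be 0 needs no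
  separate treatment.\<close>

lemma SDG_open': "SDG K \<Longrightarrow> G \<in> insert 0 K \<Longrightarrow> \<not> psd G \<Longrightarrow> \<exists>D. posdef D \<and> G - D \<in> K"
  using SDG_open psd_zero by fastforce

lemma SDG_add': "SDG K \<Longrightarrow> G \<in> insert 0 K \<Longrightarrow> H \<in> insert 0 K \<Longrightarrow> G + H \<in> insert 0 K"
  using SDG_add by auto

definition SDG_of :: "complex^'k^'k \<Rightarrow> (complex^'k^'k) set"
  where "SDG_of \<rho> = {G. hermitian G \<and> (psd_nonzero G \<or> 0 < G \<bullet> \<rho>)}"

lemma SDG_SDG_of:
  assumes \<rho>: "\<rho> \<in> density_matrices"
  shows "SDG (SDG_of \<rho>)"
  unfolding SDG_def
proof (intro conjI ballI allI impI)
  note \<rho> = density_matricesD[OF \<rho>]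
  have nonneg: "0 \<le> G \<bullet> \<rho>" if "G \<in> SDG_of \<rho>" for G
    using that psd_inner_nonneg[OF _ \<rho>(1)] by (auto simp: SDG_of_def psd_nonzero_def)
  show "SDG_of \<rho> \<subseteq> Collect hermitian" by (auto simp: SDG_of_def)
  show "0 \<notin> SDG_of \<rho>" by (simp add: SDG_of_def psd_nonzero_def)
  show "G \<in> SDG_of \<rho>" if "psd_nonzero G" for G
    using that by (simp add: SDG_of_def psd_nonzero_def psd_iff)
  show "r *\<^sub>R G \<in> SDG_of \<rho>" if "G \<in> SDG_of \<rho>" "0 < r" for G r
    using that by (auto simp: SDG_of_def psd_nonzero_def psd_scaleR hermitian_scaleR)
  show "G + H \<in> SDG_of \<rho>" if GH: "G \<in> SDG_of \<rho>" "H \<in> SDG_of \<rho>" for G H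
  \<comment> \<open>Unless both are positive semi-definite, one summand pairs strictly positively
    with \<rho> and the other nonnegatively.\<close>
  proof (cases "psd_nonzero G \<and> psd_nonzero H")
    case True
    then have "psd_nonzero (G + H)" using psd_add_eq_0 psd_add by (auto simp: psd_nonzero_def)
    with GH show ?thesis by (simp add: SDG_of_def hermitian_add)
  next
    case False
    with GH nonneg[OF GH(1)] nonneg[OF GH(2)] have "0 < (G + H) \<bullet> \<rho>"
      by (auto simp: SDG_of_def inner_add_left)
    with GH show ?thesis by (simp add: SDG_of_def hermitian_add)
  qed
  fix G assume G: "G \<in> SDG_of \<rho>"
  show "psd_nonzero G \<or> (\<exists>\<Delta>. posdef \<Delta> \<and> G - \<Delta> \<in> SDG_of \<rho>)"
  proof (cases "psd_nonzero G")
    case False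
    with G have pos: "0 < G \<bullet> \<rho>" and herm: "hermitian G" by (auto simp: SDG_of_def)
    \<comment> \<open>As \<rho> has trace one, subtracting \<open>?D\<close> removes exactly half of
      the positive value \<open>G \<bullet> \<rho>\<close>.\<close>
    let ?D = "(G \<bullet> \<rho> / 2) *\<^sub>R mat 1"
    have "posdef ?D"
      using posdef_mat_1 pos by (auto simp: posdef_def quad_form_eq intro: hermitian_scaleR)
    moreover have "0 < (G - ?D) \<bullet> \<rho>"
      using pos by (simp add: inner_diff_left mat_1_inner \<rho>)
    ultimately show ?thesis
      using herm by (auto simp: SDG_of_def hermitian_diff posdef_def)
  qed simp
qed

text \<open>By (S3) a member that is not positive semi-definite exceeds another member by a positive
  definite D, and D pairs strictly positively with \<rho>. This gives one inclusion; maximality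
  gives equality.\<close>

lemma maximal_SDG_eq_SDG_of:
  assumes K: "maximal_SDG K" and \<rho>: "\<rho> \<in> dual K"
  shows "K = SDG_of \<rho>"
proof -
  have S: "SDG K" using K by (simp add: maximal_SDG_def)
  have dens: "\<rho> \<in> density_matrices" and nonneg: "\<And>G. G \<in> K \<Longrightarrow> 0 \<le> G \<bullet> \<rho>"
    using \<rho> by (auto simp: dual_def gamble_inner_eq)
  have "G \<in> SDG_of \<rho>" if G: "G \<in> K" for G
  proof (cases "psd G")
    case True
    with G SDG_zero[OF S] show ?thesis by (auto simp: SDG_of_def psd_nonzero_def psd_iff)
  next
    case False
    with SDG_open[OF S G] obtain D where D: "posdef D" "G - D \<in> K" by blast
    have "0 < D \<bullet> \<rho>" using D(1) density_matricesD[OF dens] by (simp add: posdef_inner_pos)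
    with nonneg[OF D(2)] have "0 < G \<bullet> \<rho>" by (simp add: inner_diff_left)
    with SDG_hermitian[OF S G] show ?thesis by (simp add: SDG_of_def)
  qed
  with K SDG_SDG_of[OF dens] show ?thesis unfolding maximal_SDG_def by blast
qed

text \<open>The open half-space of \<rho> lies in \<open>K\<close>, so \<sigma> is nonnegative on
  it. The difference \<rho> - \<sigma>, shifted by a multiple of the identity, separates the two
  unless it vanishes.\<close>

lemma dual_maximal_SDG_unique:
  assumes K: "maximal_SDG K" and \<rho>: "\<rho> \<in> dual K" and \<sigma>: "\<sigma> \<in> dual K"
  shows "\<sigma> = \<rho>"
proof -
  define D where "D = \<rho> - \<sigma>"
  have dens: "\<rho> \<in> density_matrices" "\<sigma> \<in> density_matrices"
    using \<rho> \<sigma> by (auto simp: dual_def)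
  have trace: "mat 1 \<bullet> \<rho> = 1" "mat 1 \<bullet> \<sigma> = 1"
    using dens by (simp_all add: mat_1_inner density_matricesD)
  have herm: "hermitian D"
    unfolding D_def using dens by (intro hermitian_diff density_matricesD)
  have "0 \<le> D \<bullet> \<sigma> + c" if "0 < D \<bullet> \<rho> + c" for c
  proof -
    let ?G = "D + c *\<^sub>R mat 1"
    have "0 < ?G \<bullet> \<rho>" using that by (simp add: inner_add_left trace)
    then have "?G \<in> K"
      using maximal_SDG_eq_SDG_of[OF K \<rho>] herm
      by (simp add: SDG_of_def hermitian_add hermitian_scaleR hermitian_mat_1)
    then have "0 \<le> ?G \<bullet> \<sigma>" using \<sigma> by (auto simp: dual_def gamble_inner_eq)
    then show ?thesis by (simp add: inner_add_left trace)
  qed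
  \<comment> \<open>For this \<open>c\<close> the pairing with \<rho> is half of
    \<open>D \<bullet> D\<close>, and the pairing with \<sigma> is its negative.\<close>
  from this[of "(D \<bullet> D) / 2 - D \<bullet> \<rho>"]
  have "0 < D \<bullet> D \<Longrightarrow> 0 \<le> D \<bullet> \<sigma> + ((D \<bullet> D) / 2 - D \<bullet> \<rho>)" by simp
  moreover have "D \<bullet> D = D \<bullet> \<rho> - D \<bullet> \<sigma>"
    by (simp add: D_def inner_diff_right)
  ultimately have "D \<bullet> D \<le> 0" by (cases "0 < D \<bullet> D") linarith+
  then have "D = 0" by (metis inner_gt_zero_iff not_le)
  then show ?thesis by (simp add: D_def)
qed

section \<open>The joint cone and the natural extension\<close>

text \<open>Adjoining 0 lets either marginal component be absent. The cone then contains 0, which is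
  removed to form an SDG.\<close>

definition joint_cone :: "(complex^'n^'n) set \<Rightarrow> (complex^'m^'m) set \<Rightarrow>
    (complex^('n::finite \<times> 'm::finite)^('n \<times> 'm)) set"
  where "joint_cone KA KB =
    {G \<otimes> mat 1 + mat 1 \<otimes> H + P | G H P. G \<in> insert 0 KA \<and> H \<in> insert 0 KB \<and> psd P}"

text \<open>Every summand is 0 or in \<open>K\<close>. This yields both minimality of the cone and,
  through \<open>0 \<notin> K\<close>, the absence of cancellation.\<close>

lemma joint_cone_subset:
  assumes "SDG K" "KA \<subseteq> marg_A K" "KB \<subseteq> marg_B K"
  shows "joint_cone KA KB \<subseteq> insert 0 K"
proof -
  have "G \<otimes> mat 1 \<in> insert 0 K" if "G \<in> insert 0 KA" for G
    using that assms(2) by (auto simp: marg_A_def)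
  moreover have "mat 1 \<otimes> H \<in> insert 0 K" if "H \<in> insert 0 KB" for H
    using that assms(3) by (auto simp: marg_B_def)
  moreover have "P \<in> insert 0 K" if "psd P" for P
    using that SDG_psd[OF assms(1)] by (auto simp: psd_nonzero_def)
  ultimately have "G \<otimes> mat 1 + mat 1 \<otimes> H + P \<in> insert 0 K"
    if "G \<in> insert 0 KA" "H \<in> insert 0 KB" "psd P" for G H P
    using that by (intro SDG_add'[OF assms(1)])
  then show ?thesis unfolding joint_cone_def by blast
qed

lemma joint_coneI:
  "G \<in> insert 0 KA \<Longrightarrow> H \<in> insert 0 KB \<Longrightarrow> psd P \<Longrightarrow>
    G \<otimes> mat 1 + mat 1 \<otimes> H + P \<in> joint_cone KA KB"
  by (auto simp: joint_cone_def)

text \<open>The ambient \<open>K\<close> keeps sums away from 0. For (S3), a positive definite part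
  is split off a marginal component that is not positive semi-definite; if there is none, the whole
  sum is positive semi-definite.\<close>

lemma SDG_joint_cone:
  assumes A: "SDG KA" and B: "SDG KB"
    and K: "SDG K" "KA \<subseteq> marg_A K" "KB \<subseteq> marg_B K"
  shows "SDG (joint_cone KA KB - {0})"
  unfolding SDG_def
proof (intro conjI ballI allI impI)
  note sub = joint_cone_subset[OF K]
  show "0 \<notin> joint_cone KA KB - {0}" by simp
  have mem: "X \<in> K" if "X \<in> joint_cone KA KB - {0}" for X
    using sub that by auto
  show "joint_cone KA KB - {0} \<subseteq> Collect hermitian"
    using mem SDG_hermitian[OF K(1)] by auto
  show "X \<in> joint_cone KA KB - {0}" if "psd_nonzero X" for X
    using joint_coneI[of 0 KA 0 KB X] that by (simp add: psd_nonzero_def)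
  show "X + Y \<in> joint_cone KA KB - {0}"
    if X: "X \<in> joint_cone KA KB - {0}" and Y: "Y \<in> joint_cone KA KB - {0}" for X Y
  proof -
    have "X + Y \<noteq> 0"
      using SDG_add[OF K(1) mem[OF X] mem[OF Y]] SDG_zero[OF K(1)] by auto
    moreover from X obtain G H P where 1: "X = G \<otimes> mat 1 + mat 1 \<otimes> H + P"
      "G \<in> insert 0 KA" "H \<in> insert 0 KB" "psd P"
      by (auto simp only: joint_cone_def DiffE mem_Collect_eq)
    moreover from Y obtain G' H' P' where 2: "Y = G' \<otimes> mat 1 + mat 1 \<otimes> H' + P'"
      "G' \<in> insert 0 KA" "H' \<in> insert 0 KB" "psd P'"
      by (auto simp only: joint_cone_def DiffE mem_Collect_eq)
    ultimately show ?thesis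
      using joint_coneI[OF SDG_add'[OF A 1(2) 2(2)] SDG_add'[OF B 1(3) 2(3)] psd_add[OF 1(4) 2(4)]]
      by (simp add: tensor_add_left tensor_add_right algebra_simps)
  qed
  show "r *\<^sub>R X \<in> joint_cone KA KB - {0}" if X: "X \<in> joint_cone KA KB - {0}" and r: "0 < r" for X r
  proof -
    from X obtain G H P where 1: "X = G \<otimes> mat 1 + mat 1 \<otimes> H + P"
      "G \<in> insert 0 KA" "H \<in> insert 0 KB" "psd P"
      by (auto simp only: joint_cone_def DiffE mem_Collect_eq)
    have "r *\<^sub>R G \<in> insert 0 KA" "r *\<^sub>R H \<in> insert 0 KB" "psd (r *\<^sub>R P)"
      using 1 r SDG_scaleR[OF A] SDG_scaleR[OF B] by (auto simp: psd_scaleR)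
    from joint_coneI[OF this] have "r *\<^sub>R X \<in> joint_cone KA KB"
      by (simp add: 1(1) tensor_scaleR_left tensor_scaleR_right scaleR_add_right)
    with X r show ?thesis by simp
  qed
  fix X assume X: "X \<in> joint_cone KA KB - {0}"
  then obtain G H P where XE: "X = G \<otimes> mat 1 + mat 1 \<otimes> H + P"
      "G \<in> insert 0 KA" "H \<in> insert 0 KB" "psd P"
    by (auto simp only: joint_cone_def DiffE mem_Collect_eq)
  have nz: "Y + Z \<noteq> 0" if "Y \<in> K" "Z \<in> joint_cone KA KB" for Y Z
    using SDG_add[OF K(1) that(1), of Z] SDG_zero[OF K(1)] that sub by auto
  consider "psd G" "psd H" | "\<not> psd G" | "\<not> psd H" by blast
  then show "psd_nonzero X \<or> (\<exists>\<Delta>. posdef \<Delta> \<and> X - \<Delta> \<in> joint_cone KA KB - {0})"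
  proof cases
    case 1
    then have "psd X"
      unfolding XE(1) by (intro psd_add psd_tensor psd_mat_1 XE(4))
    with X show ?thesis by (simp add: psd_nonzero_def)
  next
    case 2
    then obtain D where D: "posdef D" "G - D \<in> KA" using SDG_open'[OF A XE(2)] by blast
    have "(G - D) \<otimes> mat 1 \<in> K" using D K(2) by (auto simp: marg_A_def)
    \<comment> \<open>Here \<open>insertI1\<close> puts 0 in the first slot: the remainder splits
      into \<open>(G - D) \<otimes> mat 1\<close> in \<open>K\<close> and a cone element, so it is
      nonzero.\<close>
    from nz[OF this joint_coneI[OF insertI1 XE(3,4), of KA]]
      joint_coneI[OF insertI2[OF D(2)] XE(3,4)]
    have "X - D \<otimes> mat 1 \<in> joint_cone KA KB - {0}"
      by (simp add: XE(1) tensor_diff_left algebra_simps)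
    with posdef_tensor_mat_1[OF D(1)] show ?thesis by blast
  next
    case 3
    then obtain D where D: "posdef D" "H - D \<in> KB" using SDG_open'[OF B XE(3)] by blast
    have "mat 1 \<otimes> (H - D) \<in> K" using D K(3) by (auto simp: marg_B_def)
    from nz[OF this joint_coneI[OF XE(2) insertI1 XE(4), of KB]]
      joint_coneI[OF XE(2) insertI2[OF D(2)] XE(4)]
    have "X - mat 1 \<otimes> D \<in> joint_cone KA KB - {0}"
      by (simp add: XE(1) tensor_diff_right algebra_simps)
    with posdef_mat_1_tensor[OF D(1)] show ?thesis by blast
  qed
qed

text \<open>Since \<sigma> has trace one, \<open>G \<otimes> mat 1\<close> pairs with the product
  state as \<open>G\<close> does with \<rho>; positivity and being nonzero also transfer both
  ways.\<close>

lemma marg_A_SDG_of_tensor: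
  assumes "\<rho> \<in> density_matrices" "\<sigma> \<in> density_matrices"
  shows "marg_A (SDG_of (\<rho> \<otimes> \<sigma>)) = SDG_of \<rho>"
proof -
  have "(G \<otimes> mat 1) \<bullet> (\<rho> \<otimes> \<sigma>) = G \<bullet> \<rho>" for G
    by (simp add: inner_tensor_mat_1 ptrace_B_tensor density_matricesD assms)
  then show ?thesis
    by (auto simp: marg_A_def SDG_of_def psd_nonzero_def hermitian_tensor hermitian_mat_1
        psd_tensor psd_mat_1 dest: psd_tensor_mat_1D tensor_mat_1_eq_0)
qed

lemma marg_B_SDG_of_tensor:
  assumes "\<rho> \<in> density_matrices" "\<sigma> \<in> density_matrices"
  shows "marg_B (SDG_of (\<rho> \<otimes> \<sigma>)) = SDG_of \<sigma>"
proof -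
  have "(mat 1 \<otimes> G) \<bullet> (\<rho> \<otimes> \<sigma>) = G \<bullet> \<sigma>" for G
    by (simp add: inner_mat_1_tensor ptrace_A_tensor density_matricesD assms)
  then show ?thesis
    by (auto simp: marg_B_def SDG_of_def psd_nonzero_def hermitian_tensor hermitian_mat_1
        psd_tensor psd_mat_1 dest: psd_mat_1_tensorD mat_1_tensor_eq_0)
qed

lemma marg_A_joint_cone:
  assumes "SDG KA"
  shows "KA \<subseteq> marg_A (joint_cone KA KB - {0})"
proof
  fix G assume G: "G \<in> KA"
  then have "G \<noteq> 0" using SDG_zero[OF assms] by auto
  with joint_coneI[of G KA 0 KB 0] G SDG_hermitian[OF assms G]
  show "G \<in> marg_A (joint_cone KA KB - {0})"
    by (auto simp: marg_A_def psd_zero dest: tensor_mat_1_eq_0)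
qed

lemma marg_B_joint_cone:
  assumes "SDG KB"
  shows "KB \<subseteq> marg_B (joint_cone KA KB - {0})"
proof
  fix G assume G: "G \<in> KB"
  then have "G \<noteq> 0" using SDG_zero[OF assms] by auto
  with joint_coneI[of 0 KA G KB 0] G SDG_hermitian[OF assms G]
  show "G \<in> marg_B (joint_cone KA KB - {0})"
    by (auto simp: marg_B_def psd_zero dest: mat_1_tensor_eq_0)
qed

text \<open>One SDG \<open>K\<close> with the right marginals suffices: lying inside it bounds the
  marginals of the cone from above, and they contain \<open>KA\<close> and \<open>KB\<close> by
  construction.\<close>

lemma natural_extension_eq:
  fixes KA :: "(complex^'n^'n) set" and KB :: "(complex^'m^'m) set"
  assumes "SDG KA" "SDG KB"
    and K: "SDG K" "marg_A K = KA" "marg_B K = KB"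
  shows "natural_extension KA KB = joint_cone KA KB - {0}"
  unfolding natural_extension_def
proof (rule Least_equality)
  have sub: "joint_cone KA KB - {0} \<subseteq> K"
    using joint_cone_subset[of K KA KB] K by auto
  then have "marg_A (joint_cone KA KB - {0}) \<subseteq> KA" "marg_B (joint_cone KA KB - {0}) \<subseteq> KB"
    using K(2,3) by (auto simp: marg_A_def marg_B_def)
  then show "SDG (joint_cone KA KB - {0}) \<and> marg_A (joint_cone KA KB - {0}) = KA \<and>
      marg_B (joint_cone KA KB - {0}) = KB"
    using SDG_joint_cone[OF assms(1-3)] K(2,3) marg_A_joint_cone[OF assms(1)]
      marg_B_joint_cone[OF assms(2)] by blast
  show "joint_cone KA KB - {0} \<subseteq> K'" if "SDG K' \<and> marg_A K' = KA \<and> marg_B K' = KB" for K'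
    using joint_cone_subset[of K' KA KB] that by auto
qed

section \<open>Marginals of the dual and termwise comparison\<close>

theorem theoremA16:
  fixes KA :: "(complex^'n^'n) set" and KB :: "(complex^'m^'m) set"
    and \<rho>A :: "complex^'n^'n" and \<rho>B :: "complex^'m^'m"
  assumes "maximal_SDG KA" and "maximal_SDG KB"
    and "\<rho>A \<in> dual KA" and "\<rho>B \<in> dual KB"
    and "separable_SDG (natural_extension KA KB)"
  shows "\<forall>\<rho>AB \<in> dual (natural_extension KA KB).
    \<rho>AB \<preceq> \<rho>A \<otimes> mat 1 \<and>
    \<rho>AB \<preceq> mat 1 \<otimes> \<rho>B \<and>
    \<rho>A \<otimes> mat 1 + mat 1 \<otimes> \<rho>B - mat 1 \<preceq> \<rho>AB \<and>
    psd_nonzero \<rho>AB"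
proof
  fix \<rho>AB assume \<rho>AB: "\<rho>AB \<in> dual (natural_extension KA KB)"
  have S: "SDG KA" "SDG KB" using assms(1,2) by (auto simp: maximal_SDG_def)
  have dens: "\<rho>A \<in> density_matrices" "\<rho>B \<in> density_matrices" "\<rho>AB \<in> density_matrices"
    using assms(3,4) \<rho>AB by (auto simp: dual_def)
  have "natural_extension KA KB = joint_cone KA KB - {0}"
    using S
  proof (rule natural_extension_eq)
    show "SDG (SDG_of (\<rho>A \<otimes> \<rho>B))" by (intro SDG_SDG_of density_tensor dens)
    show "marg_A (SDG_of (\<rho>A \<otimes> \<rho>B)) = KA"
      using marg_A_SDG_of_tensor[OF dens(1,2)] maximal_SDG_eq_SDG_of[OF assms(1,3)] by simp
    show "marg_B (SDG_of (\<rho>A \<otimes> \<rho>B)) = KB"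
      using marg_B_SDG_of_tensor[OF dens(1,2)] maximal_SDG_eq_SDG_of[OF assms(2,4)] by simp
  qed
  then have nonneg: "0 \<le> X \<bullet> \<rho>AB" if "X \<in> joint_cone KA KB - {0}" for X
    using \<rho>AB that by (auto simp: dual_def gamble_inner_eq)
  \<comment> \<open>Adjointness puts the partial trace in the dual of \<open>KA\<close>, whose only
    element is \<open>\<rho>A\<close>.\<close>
  have "ptrace_B \<rho>AB \<in> dual KA"
    unfolding dual_def gamble_inner_eq
  proof (intro CollectI conjI ballI)
    show "ptrace_B \<rho>AB \<in> density_matrices"
      using dens(3) by (simp add: density_matrices_def psd_ptrace_B trace_ptrace_B)
    show "0 \<le> G \<bullet> ptrace_B \<rho>AB" if "G \<in> KA" for G
      using nonneg[of "G \<otimes> mat 1"] marg_A_joint_cone[OF S(1), of KB] that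
      by (auto simp: inner_tensor_mat_1 marg_A_def)
  qed
  then have margA: "ptrace_B \<rho>AB = \<rho>A" by (rule dual_maximal_SDG_unique[OF assms(1,3)])
  have "ptrace_A \<rho>AB \<in> dual KB"
    unfolding dual_def gamble_inner_eq
  proof (intro CollectI conjI ballI)
    show "ptrace_A \<rho>AB \<in> density_matrices"
      using dens(3) by (simp add: density_matrices_def psd_ptrace_A trace_ptrace_A)
    show "0 \<le> G \<bullet> ptrace_A \<rho>AB" if "G \<in> KB" for G
      using nonneg[of "mat 1 \<otimes> G"] marg_B_joint_cone[OF S(2), of KA] that
      by (auto simp: inner_mat_1_tensor marg_B_def)
  qed
  then have margB: "ptrace_A \<rho>AB = \<rho>B" by (rule dual_maximal_SDG_unique[OF assms(2,4)])

  obtain I w \<alpha> \<beta> where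
    I: "\<And>i. i \<in> I \<Longrightarrow> w i \<ge> 0 \<and> \<alpha> i \<in> density_matrices \<and> \<beta> i \<in> density_matrices"
    and w: "(w has_sum (1::real)) (I :: nat set)"
    and sum: "((\<lambda>i. w i *\<^sub>R (\<alpha> i \<otimes> \<beta> i)) has_sum \<rho>AB) I"
    using bspec[OF assms(5)[unfolded separable_SDG_def] \<rho>AB]
    unfolding separable_density_def by (elim exE conjE) (rule that, simp_all)
  \<comment> \<open>Each \<open>\<beta> i\<close> has trace one, so the partial trace leaves a
    decomposition of \<open>\<rho>A\<close> with the same weights.\<close>
  have "((\<lambda>i. ptrace_B (w i *\<^sub>R (\<alpha> i \<otimes> \<beta> i))) has_sum \<rho>A) I"
    using has_sum_bounded_linear[OF bounded_linear_ptrace_B sum] by (simp add: margA o_def)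
  also have "?this \<longleftrightarrow> ((\<lambda>i. w i *\<^sub>R \<alpha> i) has_sum \<rho>A) I"
    by (rule has_sum_cong) (use I in \<open>simp add: linear_scale[OF bounded_linear.linear[OF bounded_linear_ptrace_B]]
        ptrace_B_tensor density_matricesD\<close>)
  finally have "((\<lambda>i. w i *\<^sub>R \<alpha> i) has_sum \<rho>A) I" .
  from has_sum_bounded_linear[OF bounded_linear_tensor_left this, of "mat 1 :: complex^'m^'m"]
  have sumA: "((\<lambda>i. w i *\<^sub>R (\<alpha> i \<otimes> mat 1)) has_sum \<rho>A \<otimes> (mat 1 :: complex^'m^'m)) I"
    by (simp add: o_def tensor_scaleR_left)
  have "((\<lambda>i. ptrace_A (w i *\<^sub>R (\<alpha> i \<otimes> \<beta> i))) has_sum \<rho>B) I"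
    using has_sum_bounded_linear[OF bounded_linear_ptrace_A sum] by (simp add: margB o_def)
  also have "?this \<longleftrightarrow> ((\<lambda>i. w i *\<^sub>R \<beta> i) has_sum \<rho>B) I"
    by (rule has_sum_cong) (use I in \<open>simp add: linear_scale[OF bounded_linear.linear[OF bounded_linear_ptrace_A]]
        ptrace_A_tensor density_matricesD\<close>)
  finally have "((\<lambda>i. w i *\<^sub>R \<beta> i) has_sum \<rho>B) I" .
  from has_sum_bounded_linear[OF bounded_linear_tensor_right this, of "mat 1 :: complex^'n^'n"]
  have sumB: "((\<lambda>i. w i *\<^sub>R (mat 1 \<otimes> \<beta> i)) has_sum (mat 1 :: complex^'n^'n) \<otimes> \<rho>B) I"
    by (simp add: o_def tensor_scaleR_right)
  \<comment> \<open>The weights sum to 1, so the identity gets a decomposition over the same index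
    set and can be compared termwise.\<close>
  have sum1: "((\<lambda>i. w i *\<^sub>R mat 1) has_sum (mat 1 :: complex^('n \<times> 'm)^('n \<times> 'm))) I"
    using has_sum_bounded_linear[OF bounded_linear_scaleR_left w,
        of "mat 1 :: complex^('n \<times> 'm)^('n \<times> 'm)"] by (simp add: o_def)

  have "\<rho>AB \<preceq> \<rho>A \<otimes> mat 1"
    unfolding psd_le_def
  proof (rule psd_has_sum[OF has_sum_diff[OF sumA sum]])
    fix i assume "i \<in> I"
    then have "psd (w i *\<^sub>R (\<alpha> i \<otimes> (mat 1 - \<beta> i)))"
      using I by (simp add: psd_scaleR psd_tensor psd_mat_1_diff_density density_matricesD)
    then show "psd (w i *\<^sub>R (\<alpha> i \<otimes> mat 1) - w i *\<^sub>R (\<alpha> i \<otimes> \<beta> i))"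
      by (simp add: tensor_diff_right scaleR_diff_right)
  qed
  moreover have "\<rho>AB \<preceq> mat 1 \<otimes> \<rho>B"
    unfolding psd_le_def
  proof (rule psd_has_sum[OF has_sum_diff[OF sumB sum]])
    fix i assume "i \<in> I"
    then have "psd (w i *\<^sub>R ((mat 1 - \<alpha> i) \<otimes> \<beta> i))"
      using I by (simp add: psd_scaleR psd_tensor psd_mat_1_diff_density density_matricesD)
    then show "psd (w i *\<^sub>R (mat 1 \<otimes> \<beta> i) - w i *\<^sub>R (\<alpha> i \<otimes> \<beta> i))"
      by (simp add: tensor_diff_left scaleR_diff_right)
  qed
  moreover have "\<rho>A \<otimes> mat 1 + mat 1 \<otimes> \<rho>B - mat 1 \<preceq> \<rho>AB"
    unfolding psd_le_def
  proof (rule psd_has_sum[OF has_sum_diff[OF sum has_sum_diff[OF has_sum_add[OF sumA sumB] sum1]]])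
    fix i assume "i \<in> I"
    then have "psd (w i *\<^sub>R ((mat 1 - \<alpha> i) \<otimes> (mat 1 - \<beta> i)))"
      using I by (simp add: psd_scaleR psd_tensor psd_mat_1_diff_density)
    also have "w i *\<^sub>R ((mat 1 - \<alpha> i) \<otimes> (mat 1 - \<beta> i)) =
      w i *\<^sub>R (\<alpha> i \<otimes> \<beta> i) - (w i *\<^sub>R (\<alpha> i \<otimes> mat 1) + w i *\<^sub>R (mat 1 \<otimes> \<beta> i) - w i *\<^sub>R mat 1)"
      by (simp add: tensor_diff_left tensor_diff_right tensor_mat_1 algebra_simps)
    finally show "psd \<dots>" .
  qed
  moreover have "psd_nonzero \<rho>AB"
    using density_matricesD[OF dens(3)] by (simp add: psd_nonzero_def)
  ultimately show "\<rho>AB \<preceq> \<rho>A \<otimes> mat 1 \<and> \<rho>AB \<preceq> mat 1 \<otimes> \<rho>B \<and>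
      \<rho>A \<otimes> mat 1 + mat 1 \<otimes> \<rho>B - mat 1 \<preceq> \<rho>AB \<and> psd_nonzero \<rho>AB"
    by blast
qed

end
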